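(* For complex numbers $a_1,a_2,a_3$ define $$ I_{\mathbb{C};2}(a_1,a_2,a_3) := \int_{\mathbb{C}^2} (1 + |z_1|^2)^{-2-a_2-a_3}(1 + |z_2|^2)^{-2-a_1-a_3}|z_1 - z_2|^{2a_3}\, dz_1\,dz_2 . $$ Then for $\Re a_1,\Re a_2,\Re a_3$ sufficiently large (i.e. there is a real constant $R$ such that for all $a_1,a_2,a_3\in\mathbb{C}$ with $\Re a_i> R$, $i=1,2,3$), $$ I_{\mathbb{C};2}(a_1,a_2,a_3) = \pi^2\,\frac{\Gamma(a_1+a_2+a_3+2)\,\Gamma(a_1+1)\,\Gamma(a_2+1)\,\Gamma(a_3+1)} {\Gamma(a_1+a_2+2)\,\Gamma(a_1+a_3+2)\,\Gamma(a_2+a_3+2)} . $$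
   Context: $dz$ denotes the standard Lebesgue (Haar) measure on $\mathbb{C}$: $dz=dx\,dy$ for $z=x+iy$. $\Gamma$ is the Euler Gamma function. *)

theory Defs
  imports "HOL-Analysis.Analysis"
begin

(* The powers have positive real bases, embedded in the complex numbers, and powr uses the
   principal branch of the logarithm, so c powr s = exp (s * ln c) with the real logarithm.
   On the diagonal z1 = z2 the last factor is 0, since 0 powr s = 0 by convention;
   the diagonal is a null set. *)
definition I_C2_integrand :: "complex \<Rightarrow> complex \<Rightarrow> complex \<Rightarrow> complex \<times> complex \<Rightarrow> complex" where
  "I_C2_integrand a1 a2 a3 = (\<lambda>(z1, z2).
     complex_of_real (1 + (cmod z1)\<^sup>2) powr (- 2 - a2 - a3) *
     complex_of_real (1 + (cmod z2)\<^sup>2) powr (- 2 - a1 - a3) *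
     complex_of_real (cmod (z1 - z2)) powr (2 * a3))"

definition I_C2 :: "complex \<Rightarrow> complex \<Rightarrow> complex \<Rightarrow> complex" where
  "I_C2 a1 a2 a3 = (LINT z|lborel. I_C2_integrand a1 a2 a3 z)"

end

theory Submission imports Defs begin

text \<open>
  Write each factor \<open>(1 + |z|\<^sup>2) powr (- b - 1)\<close>, up to \<open>Gamma (b + 1)\<close>, as the Laplace integral
  of \<open>t powr b\<close> against \<open>exp (- t (1 + |z|\<^sup>2))\<close> and exchange the order of integration. For fixed
  \<open>t\<close> and \<open>s\<close> the integral over \<open>(z1, z2)\<close> is Gaussian: completing the square in \<open>z2\<close> along
  \<open>z1 - z2 = w\<close> leaves a moment of a Gaussian with parameter \<open>t s / (t + s)\<close>. What remains is the
  integral of \<open>t powr a2 * s powr a1 * (t + s) powr a3 * exp (- t - s)\<close>, which factors under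
  \<open>t = s \<tau>\<close> into \<open>Gamma (a1 + a2 + a3 + 2)\<close> and a constant independent of \<open>a3\<close>; the case
  \<open>a3 = 0\<close> identifies the constant as a Beta value. Absolute convergence follows from
  \<open>|z1 - z2|\<^sup>2 \<le> (1 + |z1|\<^sup>2) (1 + |z2|\<^sup>2)\<close>, and \<open>R = 0\<close> suffices.
\<close>

section \<open>Complex powers of real functions and the Gamma integral with a rate\<close>

lemma borel_measurable_of_real_powr [measurable]:
  assumes [measurable]: "f \<in> borel_measurable M"
  shows "(\<lambda>x. complex_of_real (f x) powr a) \<in> borel_measurable M"
proof -
  \<comment> \<open>The sign of the base selects the branch of the logarithm: on the negative axis
    \<open>Ln\<close> contributes \<open>\<i> * pi\<close>, and at 0 the power is 0 by convention.
    Each case is a measurable function of a real variable.\<close>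
  have *: "complex_of_real x powr a =
     (if x > 0 then exp (a * of_real (ln x)) else if x = 0 then 0 else exp (a * (of_real (ln (-x)) + \<i> * pi)))" for x
    using Ln_of_real[of x] Ln_minus[of "of_real (-x)"]
    by (auto simp: powr_def Ln_of_real simp flip: of_real_minus)
  show ?thesis unfolding * by measurable
qed

lemma borel_measurable_fst_snd [measurable (raw)]:
  fixes f :: "'c \<Rightarrow> 'a::second_countable_topology \<times> 'b::second_countable_topology"
  assumes "f \<in> borel_measurable M"
  shows "(\<lambda>x. fst (f x)) \<in> borel_measurable M" "(\<lambda>x. snd (f x)) \<in> borel_measurable M"
  using assms unfolding borel_prod [symmetric] by (auto intro: measurable_fst'' measurable_snd'')

text \<open>Extension by zero to the whole line lets affine substitution and Fubini be applied over
  \<open>lborel\<close> directly, and it keeps the base of the power positive wherever the value is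
  not 0.\<close>

definition gamma_kernel :: "complex \<Rightarrow> real \<Rightarrow> real \<Rightarrow> complex" where
  "gamma_kernel a c t = indicator {0<..} t *\<^sub>R (of_real t powr a * of_real (exp (- c * t)))"

lemma borel_measurable_gamma_kernel [measurable]:
  assumes [measurable]: "f \<in> borel_measurable M" "g \<in> borel_measurable M"
  shows "(\<lambda>x. gamma_kernel a (f x) (g x)) \<in> borel_measurable M"
  unfolding gamma_kernel_def by measurable

lemma of_real_norm_of_real_powr:
  "x \<ge> 0 \<Longrightarrow> of_real (norm (complex_of_real x powr a)) = complex_of_real x powr of_real (Re a)"
  by (cases "x = 0") (simp_all add: norm_powr_real_powr powr_of_real)

text \<open>The norm of a kernel is again a kernel, with real exponent. Absolute convergence can
  therefore be read off from the same integral formulas taken at the real parts of the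
  parameters.\<close>

lemma of_real_norm_gamma_kernel:
  "of_real (norm (gamma_kernel a c t)) = gamma_kernel (of_real (Re a)) c t"
  by (auto simp: gamma_kernel_def indicator_def norm_mult of_real_norm_of_real_powr)

lemma integrable_gamma_kernel:
  assumes "Re a > -1" "c > 0"
  shows "integrable lborel (gamma_kernel a c)"
proof -
  have "set_integrable lebesgue {0<..} (\<lambda>t. complex_of_real t powr (a + 1 - 1) / of_real (exp (c * t)))"
    by (rule absolutely_integrable_Gamma_integral) (use assms in auto)
  then have "integrable lebesgue (gamma_kernel a c)"
    unfolding set_integrable_def
    by (rule back_subst[where P = "integrable _"]) (auto simp: fun_eq_iff gamma_kernel_def exp_minus field_simps)
  \<comment> \<open>For a Borel function, integrability over the completed measure and over
    \<open>lborel\<close> coincide.\<close>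
  then show ?thesis by (subst (asm) integrable_completion) auto
qed

text \<open>Rate 1 is Euler's integral. Scaling the variable by \<open>c\<close> produces the
  Jacobian \<open>c\<close> and a factor \<open>c powr a\<close>, together
  \<open>c powr (a + 1)\<close>.\<close>

lemma integral_gamma_kernel:
  assumes "Re a > -1" "c > 0"
  shows "integral\<^sup>L lborel (gamma_kernel a c) = Gamma (a + 1) * of_real c powr (- a - 1)"
proof -
  have 1: "integral\<^sup>L lborel (gamma_kernel a 1) = Gamma (a + 1)"
  proof -
    have "(gamma_kernel a 1 has_integral integral\<^sup>L lborel (gamma_kernel a 1)) UNIV"
      using assms by (intro has_integral_integral_lborel integrable_gamma_kernel) auto
    moreover have "((\<lambda>t. of_real t powr (a + 1 - 1) / of_real (exp t)) has_integral Gamma (a + 1)) {0<..}"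
      by (rule Gamma_integral_complex') (use assms in auto)
    then have "(gamma_kernel a 1 has_integral Gamma (a + 1)) UNIV"
      by (subst (asm) has_integral_restrict_UNIV [symmetric], elim back_subst[where P = "\<lambda>f. (f has_integral _) UNIV"])
        (auto simp: fun_eq_iff gamma_kernel_def exp_minus field_simps)
    ultimately show ?thesis by (rule has_integral_unique)
  qed
  have "integral\<^sup>L lborel (gamma_kernel a 1) = \<bar>c\<bar> *\<^sub>R (\<integral>t. gamma_kernel a 1 (0 + c * t) \<partial>lborel)"
    using assms by (intro lborel_integral_real_affine) auto
  also have "(\<lambda>t. gamma_kernel a 1 (0 + c * t)) = (\<lambda>t. of_real c powr a * gamma_kernel a c t)"
    using assms by (auto simp: fun_eq_iff gamma_kernel_def indicator_def zero_less_mult_iff powr_times_real)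
  finally have "Gamma (a + 1) = (of_real c * of_real c powr a) * integral\<^sup>L lborel (gamma_kernel a c)"
    using assms by (simp add: 1 scaleR_conv_of_real)
  also have "of_real c * of_real c powr a = of_real c powr (a + 1)"
    using assms by (simp add: powr_add)
  finally show ?thesis using assms
    by (simp add: field_simps powr_diff powr_minus powr_add)
qed

section \<open>Radial and Gaussian integrals on the complex plane\<close>

text \<open>A disc of radius \<open>sqrt x\<close> has area \<open>pi * x\<close>, so both measures
  agree on the half-lines \<open>{..x}\<close>. These are closed under intersection and generate the
  Borel sets.\<close>

lemma distr_cmod_square:
  "distr lborel borel (\<lambda>z. (cmod z)\<^sup>2) = density lborel (\<lambda>r. ennreal (pi * indicator {0<..} r))"
  (is "?M = ?N")
proof (rule measure_eqI_generator_eq[where E = "range atMost" and \<Omega> = UNIV and A = "\<lambda>n. {..real n}"])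
  have eq: "emeasure ?M {..x} = ennreal (pi * max 0 x)" "emeasure ?N {..x} = ennreal (pi * max 0 x)" for x
  proof -
    have "emeasure ?M {..x} = emeasure lborel {z. (cmod z)\<^sup>2 \<le> x}"
      by (subst emeasure_distr) (auto simp: vimage_def)
    also have "{z. (cmod z)\<^sup>2 \<le> x} = (if x < 0 then {} else cball 0 (sqrt x))"
    proof -
      have "x \<ge> 0" if "(cmod z)\<^sup>2 \<le> x" for z
        using zero_le_power2[of "cmod z"] that by linarith
      moreover have "(cmod z)\<^sup>2 \<le> x \<longleftrightarrow> cmod z \<le> sqrt x" for z
        using real_sqrt_le_iff[of "(cmod z)\<^sup>2" x] by simp
      ultimately show ?thesis by force
    qed
    also have "emeasure lborel \<dots> = ennreal (pi * max 0 x)"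
      by (auto simp: emeasure_cball unit_ball_vol_2)
    finally show "emeasure ?M {..x} = ennreal (pi * max 0 x)" .
    have "emeasure ?N {..x} = (\<integral>\<^sup>+r. ennreal pi * indicator {0<..x} r \<partial>lborel)"
      by (subst emeasure_density) (auto intro!: nn_integral_cong simp: indicator_def)
    also have "\<dots> = ennreal (pi * max 0 x)"
      by (subst nn_integral_cmult_indicator) (auto simp: max_def ennreal_mult)
    finally show "emeasure ?N {..x} = ennreal (pi * max 0 x)" .
  qed
  show "Int_stable (range (atMost :: real \<Rightarrow> _))"
    by (auto simp: Int_stable_def)
  show "sets ?M = sigma_sets UNIV (range (atMost :: real \<Rightarrow> _))"
       "sets ?N = sigma_sets UNIV (range (atMost :: real \<Rightarrow> _))"
    by (simp_all add: borel_eq_atMost)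
  show "(\<Union>n. {..real n}) = UNIV" using real_arch_simple by auto
  show "emeasure ?M X = emeasure ?N X" if "X \<in> range atMost" for X
    using that by (auto simp: eq)
  show "emeasure ?M {..real n} \<noteq> \<infinity>" for n
    by (simp add: eq)
qed auto

text \<open>This takes the place of polar coordinates: in the variable r = |z|^2 the Jacobian is the
  constant \<open>pi\<close>.\<close>

lemma has_bochner_integral_cmod_square:
  fixes f :: "real \<Rightarrow> complex" and I :: complex
  assumes "has_bochner_integral lborel (\<lambda>r. indicator {0<..} r *\<^sub>R f r) I" and [measurable]: "f \<in> borel_measurable borel"
  shows "has_bochner_integral lborel (\<lambda>z. f ((cmod z)\<^sup>2)) (pi * I)"
proof -
  have "has_bochner_integral lborel (\<lambda>r. pi *\<^sub>R (indicator {0<..} r *\<^sub>R f r)) (pi *\<^sub>R I)"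
    by (intro has_bochner_integral_scaleR_right assms)
  then have "has_bochner_integral (density lborel (\<lambda>r. ennreal (pi * indicator {0<..} r))) f (pi *\<^sub>R I)"
    by (intro has_bochner_integral_density) (auto simp: indicator_def)
  then have "has_bochner_integral (distr lborel borel (\<lambda>z. (cmod z)\<^sup>2)) f (pi *\<^sub>R I)"
    unfolding distr_cmod_square .
  then show ?thesis by (simp add: has_bochner_integral_iff integrable_distr_eq integral_distr scaleR_conv_of_real)
qed

lemma of_real_square_powr: "x \<ge> 0 \<Longrightarrow> (complex_of_real x)\<^sup>2 powr a = complex_of_real x powr (2 * a)"
  by (cases "x = 0") (auto simp: powr_def ln_realpow Ln_of_real mult_ac simp flip: of_real_power)

lemma has_bochner_integral_cmod_powr_gauss:
  assumes "Re a > -1" "c > 0"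
  shows "has_bochner_integral lborel (\<lambda>z. complex_of_real (cmod z) powr (2 * a) * of_real (exp (- c * (cmod z)\<^sup>2)))
           (of_real pi * (Gamma (a + 1) * of_real c powr (- a - 1)))"
proof -
  have "has_bochner_integral lborel (\<lambda>r. indicator {0<..} r *\<^sub>R (of_real r powr a * of_real (exp (- c * r))))
           (Gamma (a + 1) * complex_of_real c powr (- a - 1))"
    using integrable_gamma_kernel[OF assms] integral_gamma_kernel[OF assms]
    by (simp add: has_bochner_integral_iff gamma_kernel_def[abs_def])
  from has_bochner_integral_cmod_square[OF this] show ?thesis
    by (simp add: of_real_square_powr)
qed

lemma gamma_kernel_0: "gamma_kernel 0 c = (\<lambda>t. indicator {0<..} t *\<^sub>R of_real (exp (- c * t)))"
  by (auto simp: gamma_kernel_def fun_eq_iff indicator_def)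

text \<open>This is the moment of order 0, derived from the kernel because the convention that 0
  powr 0 is 0 would change the integrand at the origin.\<close>

lemma has_bochner_integral_gauss:
  assumes "c > 0"
  shows "has_bochner_integral lborel (\<lambda>z::complex. complex_of_real (exp (- c * (cmod z)\<^sup>2))) (of_real (pi / c))"
proof -
  have "has_bochner_integral lborel (\<lambda>r. indicator {0<..} r *\<^sub>R complex_of_real (exp (- c * r))) (of_real (1 / c))"
    using integrable_gamma_kernel[of 0 c] integral_gamma_kernel[of 0 c] assms
    by (simp add: has_bochner_integral_iff gamma_kernel_0 powr_minus_divide)
  from has_bochner_integral_cmod_square[OF this] show ?thesis by simp
qed

lemma has_bochner_integral_lborel_translate:
  fixes b :: "'a :: euclidean_space" and f :: "'a \<Rightarrow> 'b :: {banach, second_countable_topology}"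
  assumes "has_bochner_integral lborel f I"
  shows "has_bochner_integral lborel (\<lambda>z. f (b + z)) I"
proof -
  have "has_bochner_integral (distr lborel borel ((+) b)) f I"
    using assms by (simp add: lborel_distr_plus)
  then show ?thesis
    using borel_measurable_has_bochner_integral[OF assms]
    by (simp add: integrable_distr_eq integral_distr has_bochner_integral_iff integrable_distr_eq integral_distr)
qed

text \<open>The real identity is applied to real and imaginary parts separately. It exhibits a
  translated Gaussian in \<open>z\<close> of rate \<open>t + s\<close> and leaves one in
  \<open>w\<close> of rate \<open>t * s / (t + s)\<close>.\<close>

lemma complete_square_cmod:
  fixes t s :: real
  assumes "t > 0" "s > 0"
  shows "t * (cmod (w + z))\<^sup>2 + s * (cmod z)\<^sup>2 =
           (t + s) * (cmod (of_real (t / (t + s)) * w + z))\<^sup>2 + t * s / (t + s) * (cmod w)\<^sup>2"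
proof -
  have real: "t * (x + y)\<^sup>2 + s * y\<^sup>2 = (t + s) * (t / (t + s) * x + y)\<^sup>2 + t * s / (t + s) * x\<^sup>2" for x y :: real
  proof -
    \<comment> \<open>Eliminating \<open>s\<close> leaves \<open>u\<close> as the only
      denominator.\<close>
    define u where "u = t + s"
    have u: "u \<noteq> 0" and s: "s = u - t" using assms by (auto simp: u_def)
    show ?thesis unfolding u_def [symmetric] unfolding s
      using u by (simp add: divide_simps) (simp add: algebra_simps power2_eq_square)
  qed
  show ?thesis
    using real[of "Re w" "Re z"] real[of "Im w" "Im z"] by (simp add: cmod_power2 algebra_simps)
qed

lemma has_bochner_integral_two_gauss:
  fixes w :: complex
  assumes "t > 0" "s > 0"
  shows "has_bochner_integral lborel (\<lambda>z. complex_of_real (exp (- t * (cmod (w + z))\<^sup>2 - s * (cmod z)\<^sup>2)))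
           (of_real (pi / (t + s)) * of_real (exp (- (t * s / (t + s)) * (cmod w)\<^sup>2)))"
proof -
  have "has_bochner_integral lborel
      (\<lambda>z. complex_of_real (exp (- (t + s) * (cmod (of_real (t / (t + s)) * w + z))\<^sup>2)) *
           of_real (exp (- (t * s / (t + s)) * (cmod w)\<^sup>2)))
      (of_real (pi / (t + s)) * of_real (exp (- (t * s / (t + s)) * (cmod w)\<^sup>2)))"
    using assms
    by (intro has_bochner_integral_mult_left impI has_bochner_integral_lborel_translate has_bochner_integral_gauss) auto
  also have "(\<lambda>z. complex_of_real (exp (- (t + s) * (cmod (of_real (t / (t + s)) * w + z))\<^sup>2)) *
           of_real (exp (- (t * s / (t + s)) * (cmod w)\<^sup>2))) =
      (\<lambda>z. complex_of_real (exp (- t * (cmod (w + z))\<^sup>2 - s * (cmod z)\<^sup>2)))"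
    using complete_square_cmod[OF assms, of w]
    by (simp add: fun_eq_iff algebra_simps flip: of_real_mult exp_add)
  finally show ?thesis .
qed

section \<open>Iterated integration and the Gaussian integral over pairs\<close>

text \<open>A form of Fubini's theorem for inner integrals known in closed form: \<open>h\<close>
  yields absolute integrability and \<open>g\<close> the value. Since \<open>h\<close> is complex
  valued, one evaluation formula can supply both.\<close>

lemma has_bochner_integral_lborel_pair:
  fixes f :: "'a::euclidean_space \<times> 'b::euclidean_space \<Rightarrow> complex"
  assumes f [measurable]: "f \<in> borel_measurable borel"
    and g: "\<And>x. has_bochner_integral lborel (\<lambda>y. f (x, y)) (g x)"
    and h: "\<And>x. has_bochner_integral lborel (\<lambda>y. complex_of_real (norm (f (x, y)))) (h x)"
    and "integrable lborel h" "has_bochner_integral lborel g I"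
  shows "has_bochner_integral lborel f I"
proof -
  have m: "f \<in> borel_measurable (lborel \<Otimes>\<^sub>M lborel)" by (simp add: lborel_prod)
  have "(\<integral>y. norm (f (x, y)) \<partial>lborel) = Re (h x)" for x
    using has_bochner_integral_integral_eq[OF h[of x]] by (metis integral_complex_of_real Re_complex_of_real)
  then have int: "integrable (lborel \<Otimes>\<^sub>M lborel) f"
    using assms by (intro lborel_pair.Fubini_integrable m) (auto simp: has_bochner_integral_iff)
  have "integral\<^sup>L (lborel \<Otimes>\<^sub>M lborel) f = (\<integral>x. \<integral>y. f (x, y) \<partial>lborel \<partial>lborel)"
    using lborel_pair.integral_fst'[OF int] by simp
  also have "\<dots> = I"
    using assms(5) g by (simp add: has_bochner_integral_iff)
  finally show ?thesis using int by (simp add: has_bochner_integral_iff lborel_prod)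
qed

text \<open>For each fixed second coordinate the shear is a translation of the first, so Tonelli
  reduces the claim to translation invariance. It serves to make the difference
  \<open>z1 - z2\<close> a coordinate.\<close>

lemma lborel_distr_shear:
  "distr lborel borel (\<lambda>(w, z). (w + z, z)) = (lborel :: ('a::euclidean_space \<times> 'a) measure)"
proof (rule measure_eqI)
  fix A :: "('a \<times> 'a) set"
  assume "A \<in> sets (distr lborel borel (\<lambda>(w, z). (w + z, z)))"
  then have A [measurable]: "A \<in> sets borel" by simp
  have T [measurable]: "(\<lambda>(w, z). (w + z, z)) \<in> borel_measurable (borel :: ('a \<times> 'a) measure)"
    unfolding case_prod_unfold by measurable
  have trans: "(\<integral>\<^sup>+w. f (w + z) \<partial>lborel) = (\<integral>\<^sup>+w. f w \<partial>lborel)"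
    if [measurable]: "f \<in> borel_measurable borel" for f and z :: 'a
    by (subst (2) lborel_distr_plus[of z, symmetric], subst nn_integral_distr) (auto simp: add.commute)
  have "emeasure (distr lborel borel (\<lambda>(w, z). (w + z, z))) A
      = (\<integral>\<^sup>+p. indicator A ((\<lambda>(w, z). (w + z, z)) p) \<partial>lborel)"
    by (subst nn_integral_indicator[symmetric], simp, subst nn_integral_distr) auto
  also have "\<dots> = (\<integral>\<^sup>+z. \<integral>\<^sup>+w. indicator A (w + z, z) \<partial>lborel \<partial>lborel)"
    unfolding lborel_prod[symmetric]
    by (subst lborel_pair.nn_integral_snd[symmetric]) (auto simp: lborel_prod)
  also have "\<dots> = (\<integral>\<^sup>+z. \<integral>\<^sup>+w. indicator A (w, z) \<partial>lborel \<partial>lborel)"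
    by (subst trans) auto
  also have "\<dots> = emeasure lborel A"
    unfolding lborel_prod[symmetric]
    by (subst lborel_pair.nn_integral_snd) (auto simp: lborel_prod)
  finally show "emeasure (distr lborel borel (\<lambda>(w, z). (w + z, z))) A = emeasure lborel A" .
qed simp

lemma has_bochner_integral_gauss_pair:
  fixes t s :: real
  assumes a: "Re a > -1" and ts: "t > 0" "s > 0"
  shows "has_bochner_integral lborel
      (\<lambda>(z1, z2). complex_of_real (cmod (z1 - z2)) powr (2 * a) *
         of_real (exp (- t * (cmod z1)\<^sup>2 - s * (cmod z2)\<^sup>2)))
      ((of_real pi)\<^sup>2 * Gamma (a + 1) * of_real (t + s) powr a * of_real t powr (- a - 1) * of_real s powr (- a - 1))"
    (is "has_bochner_integral _ ?g ?I")
proof -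
  define c where "c = t * s / (t + s)"
  have c: "c > 0" using ts by (simp add: c_def)
  \<comment> \<open>In the coordinates w = z1 - z2 and z = z2 the power depends on \<open>w\<close>
    alone. The exponent stays a parameter because both \<open>a\<close> and \<open>Re a\<close> are
    inserted, the latter giving the norm.\<close>
  define \<Phi> where "\<Phi> b = (\<lambda>(w, z). complex_of_real (cmod w) powr (2 * b) *
    of_real (exp (- t * (cmod (w + z))\<^sup>2 - s * (cmod z)\<^sup>2)))" for b
  define \<phi> where "\<phi> b = (\<lambda>w. complex_of_real (cmod w) powr (2 * b) *
    (of_real (pi / (t + s)) * of_real (exp (- c * (cmod w)\<^sup>2))))" for b
  have inner: "has_bochner_integral lborel (\<lambda>z. \<Phi> b (w, z)) (\<phi> b w)" for b w
    unfolding \<Phi>_def \<phi>_def prod.case c_def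
    by (intro has_bochner_integral_mult_right impI has_bochner_integral_two_gauss ts)
  have outer: "has_bochner_integral lborel (\<phi> b)
      (of_real (pi / (t + s)) * (of_real pi * (Gamma (b + 1) * of_real c powr (- b - 1))))" if "Re b > -1" for b
    using has_bochner_integral_mult_right[OF has_bochner_integral_cmod_powr_gauss[OF that c],
        where c = "complex_of_real (pi / (t + s))"]
    unfolding \<phi>_def by (simp add: mult_ac)
  have norm: "complex_of_real (norm (\<Phi> a p)) = \<Phi> (of_real (Re a)) p" for p
    by (cases p) (simp add: \<Phi>_def norm_mult of_real_norm_of_real_powr)
  have m [measurable]: "\<Phi> a \<in> borel_measurable borel"
    unfolding \<Phi>_def case_prod_unfold by measurable
  have "has_bochner_integral lborel (\<Phi> a)
     (of_real (pi / (t + s)) * (of_real pi * (Gamma (a + 1) * of_real c powr (- a - 1))))"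
    using outer[of a] outer[of "of_real (Re a)"] a
    by (intro has_bochner_integral_lborel_pair[OF m inner[of a]])
       (auto simp: norm intro: inner integrable.intros)
  also have "\<Phi> a = (\<lambda>p. ?g ((\<lambda>(w, z). (w + z, z)) p))"
    by (auto simp: \<Phi>_def fun_eq_iff)
  finally have "has_bochner_integral (distr lborel borel (\<lambda>(w, z). (w + z, z))) ?g
     (of_real (pi / (t + s)) * (of_real pi * (Gamma (a + 1) * of_real c powr (- a - 1))))"
    by (subst has_bochner_integral_distr) (auto simp: case_prod_unfold)
  also have "of_real (pi / (t + s)) * (of_real pi * (Gamma (a + 1) * of_real c powr (- a - 1))) = ?I"
  proof -
    \<comment> \<open>The power of \<open>c\<close> contributes \<open>t + s\<close> to the exponent
      \<open>a + 1\<close>; the factor \<open>pi / (t + s)\<close> of the inner integral lowers it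
      to \<open>a\<close>.\<close>
    have "complex_of_real c powr (- a - 1) =
        of_real t powr (- a - 1) * of_real s powr (- a - 1) * of_real (t + s) powr (a + 1)"
    proof -
      have ln_c: "ln c = ln t + ln s - ln (t + s)"
        using ts by (simp add: c_def ln_div ln_mult)
      show ?thesis
        using ts c by (simp add: powr_def Ln_of_real ln_c algebra_simps flip: exp_add of_real_add) (simp add: algebra_simps)
    qed
    moreover have "complex_of_real (t + s) powr (a + 1) = of_real (t + s) powr a * of_real (t + s)"
      using ts by (simp add: powr_add flip: of_real_add)
    ultimately show ?thesis using ts by (simp add: field_simps power2_eq_square flip: of_real_add)
  qed
  finally show ?thesis unfolding lborel_distr_shear .
qed

section \<open>The integral over the Laplace variables and its Beta value\<close>

text \<open>A majorant used twice: for the integral over the ratio \<open>\<tau>\<close> and, with x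
  = |z|^2, for integrals over the plane.\<close>

lemma integrable_inverse_square_shift:
  "integrable lborel (\<lambda>x::real. indicator {0<..} x *\<^sub>R (1 / (1 + x)\<^sup>2))"
proof (rule integrableI_bounded)
  have "(\<integral>\<^sup>+x. ennreal (1 / (1 + x)\<^sup>2) * indicator {0..} x \<partial>lborel) = ennreal (0 - (- 1 / (1 + 0)))"
  proof (rule nn_integral_FTC_atLeast)
    show "((\<lambda>x::real. - 1 / (1 + x)) has_real_derivative 1 / (1 + x)\<^sup>2) (at x)" if "0 \<le> x" for x
      using that by (auto intro!: derivative_eq_intros simp: power2_eq_square)
    show "((\<lambda>x::real. - 1 / (1 + x)) \<longlongrightarrow> 0) at_top"
      by (intro tendsto_divide_0[OF tendsto_const] filterlim_at_top_imp_at_infinity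
          filterlim_tendsto_add_at_top[OF tendsto_const] filterlim_ident)
  qed auto
  moreover have "(\<integral>\<^sup>+x. ennreal (norm (indicator {0<..} x *\<^sub>R (1 / (1 + x :: real)\<^sup>2))) \<partial>lborel) \<le>
      (\<integral>\<^sup>+x. ennreal (1 / (1 + x)\<^sup>2) * indicator {0..} x \<partial>lborel)"
    by (intro nn_integral_mono) (auto simp: indicator_def)
  ultimately show "(\<integral>\<^sup>+x. ennreal (norm (indicator {0<..} x *\<^sub>R (1 / (1 + x :: real)\<^sup>2))) \<partial>lborel) < \<infinity>"
    by (auto simp: le_less_trans)
qed auto

text \<open>After t = s \<tau> the integrand is a function of \<open>\<tau>\<close> times a Gamma
  kernel in \<open>s\<close> of exponent \<open>a1 + a2 + a3 + 1\<close> and rate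
  \<open>1 + \<tau>\<close>, so the \<open>s\<close> integral is explicit.\<close>

lemma integral_gamma_kernel_pair:
  assumes a: "Re a1 \<ge> 0" "Re a2 \<ge> 0" "Re a3 \<ge> 0"
    and int: "integrable lborel (\<lambda>(t, s). gamma_kernel a2 1 t * gamma_kernel a1 1 s * complex_of_real (t + s) powr a3)"
  shows "(\<integral>(t, s). gamma_kernel a2 1 t * gamma_kernel a1 1 s * complex_of_real (t + s) powr a3 \<partial>lborel) =
     Gamma (a1 + a2 + a3 + 2) *
     (\<integral>\<tau>. indicator {0<..} \<tau> *\<^sub>R (of_real \<tau> powr a2 * of_real (1 + \<tau>) powr (- a1 - a2 - 2)) \<partial>lborel)"
    (is "?lhs = _ * integral\<^sup>L _ (?k a1 a2)")
proof -
  \<comment> \<open>The absolute value keeps the rate of the kernel positive for every \<open>\<tau>\<close>; only \<open>\<tau> > 0\<close> matters.\<close>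
  define Q where "Q b1 b2 b3 = (\<lambda>(\<tau>, s). indicator {0<..} \<tau> *\<^sub>R (of_real \<tau> powr b2 * of_real (1 + \<tau>) powr b3) *
    gamma_kernel (b1 + b2 + b3 + 1) (1 + \<bar>\<tau>\<bar>) s)" for b1 b2 b3
  have m [measurable]: "Q a1 a2 a3 \<in> borel_measurable borel"
    unfolding Q_def case_prod_unfold by measurable
  have k: "integrable lborel (?k b1 b2)" if "Re b1 \<ge> 0" "Re b2 \<ge> 0" for b1 b2
  proof (rule Bochner_Integration.integrable_bound[OF integrable_inverse_square_shift])
    show "AE \<tau> in lborel. norm (?k b1 b2 \<tau>) \<le> norm (indicator {0<..} \<tau> *\<^sub>R (1 / (1 + \<tau>)\<^sup>2))"
    proof (intro AE_I2)
      fix \<tau> :: real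
      \<comment> \<open>Bounding \<open>\<tau>\<close> by \<open>1 + \<tau>\<close> absorbs the
        first power and leaves the exponent \<open>- Re b1 - 2\<close>, which is at most -2.\<close>
      have "\<tau> powr Re b2 * (1 + \<tau>) powr (- Re b1 - Re b2 - 2) \<le> 1 / (1 + \<tau>)\<^sup>2" if "\<tau> > 0"
      proof -
        have "\<tau> powr Re b2 * (1 + \<tau>) powr (- Re b1 - Re b2 - 2)
           \<le> (1 + \<tau>) powr Re b2 * (1 + \<tau>) powr (- Re b1 - Re b2 - 2)"
          using \<open>\<tau> > 0\<close> \<open>Re b2 \<ge> 0\<close> by (intro mult_right_mono powr_mono2) auto
        also have "\<dots> = (1 + \<tau>) powr (- Re b1 - 2)" by (simp flip: powr_add)
        also have "\<dots> \<le> (1 + \<tau>) powr (- 2)"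
          using \<open>\<tau> > 0\<close> \<open>Re b1 \<ge> 0\<close> by (intro powr_mono) auto
        finally show ?thesis using \<open>\<tau> > 0\<close> by (simp add: powr_minus_divide)
      qed
      moreover have "cmod (complex_of_real (1 + \<tau>) powr z) = (1 + \<tau>) powr Re z" if "\<tau> > 0" for z
        using that by (subst norm_powr_real_powr) auto
      ultimately show "norm (?k b1 b2 \<tau>) \<le> norm (indicator {0<..} \<tau> *\<^sub>R (1 / (1 + \<tau>)\<^sup>2))"
        by (auto simp: indicator_def norm_mult norm_powr_real_powr)
    qed
  qed measurable
  have inner: "has_bochner_integral lborel (\<lambda>s. Q b1 b2 b3 (\<tau>, s)) (Gamma (b1 + b2 + b3 + 2) * ?k b1 b2 \<tau>)"
    if "Re b1 \<ge> 0" "Re b2 \<ge> 0" "Re b3 \<ge> 0" for b1 b2 b3 \<tau>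
  proof -
    have "has_bochner_integral lborel (gamma_kernel (b1 + b2 + b3 + 1) (1 + \<bar>\<tau>\<bar>))
      (Gamma (b1 + b2 + b3 + 1 + 1) * of_real (1 + \<bar>\<tau>\<bar>) powr (- (b1 + b2 + b3 + 1) - 1))"
      using that by (simp only: has_bochner_integral_iff) (intro conjI integrable_gamma_kernel integral_gamma_kernel; simp)
    then have "has_bochner_integral lborel (\<lambda>s. Q b1 b2 b3 (\<tau>, s))
      (indicator {0<..} \<tau> *\<^sub>R (of_real \<tau> powr b2 * of_real (1 + \<tau>) powr b3) *
      (Gamma (b1 + b2 + b3 + 1 + 1) * of_real (1 + \<bar>\<tau>\<bar>) powr (- (b1 + b2 + b3 + 1) - 1)))"
      unfolding Q_def prod.case by (intro has_bochner_integral_mult_right) auto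
    also have "indicator {0<..} \<tau> *\<^sub>R (of_real \<tau> powr b2 * of_real (1 + \<tau>) powr b3) *
      (Gamma (b1 + b2 + b3 + 1 + 1) * of_real (1 + \<bar>\<tau>\<bar>) powr (- (b1 + b2 + b3 + 1) - 1)) =
      Gamma (b1 + b2 + b3 + 2) * ?k b1 b2 \<tau>"
    proof (cases "\<tau> > 0")
      case True
      \<comment> \<open>Here \<open>b3\<close> cancels, so the remaining \<open>\<tau>\<close>
        integral does not depend on it.\<close>
      have "complex_of_real (1 + \<tau>) powr b3 * of_real (1 + \<tau>) powr (- (b1 + b2 + b3 + 1) - 1) =
            of_real (1 + \<tau>) powr (- b1 - b2 - 2)"
        by (simp add: algebra_simps flip: powr_add)
      then show ?thesis using True by (simp add: algebra_simps)
    qed auto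
    finally show ?thesis .
  qed
  have norm: "complex_of_real (norm (Q a1 a2 a3 p)) = Q (of_real (Re a1)) (of_real (Re a2)) (of_real (Re a3)) p" for p
  proof (cases p)
    case (Pair \<tau> s)
    have "complex_of_real (norm (complex_of_real (1 + \<tau>) powr a3)) = complex_of_real (1 + \<tau>) powr of_real (Re a3)"
      if "\<tau> > 0" using that by (intro of_real_norm_of_real_powr) auto
    then show ?thesis
      by (auto simp: Pair Q_def norm_mult of_real_norm_gamma_kernel of_real_norm_of_real_powr indicator_def)
  qed
  have Q: "has_bochner_integral lborel (Q a1 a2 a3) (Gamma (a1 + a2 + a3 + 2) * integral\<^sup>L lborel (?k a1 a2))"
  proof (rule has_bochner_integral_lborel_pair[OF m inner[OF a]])
    show "has_bochner_integral lborel (\<lambda>s. complex_of_real (norm (Q a1 a2 a3 (\<tau>, s))))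
        (Gamma (of_real (Re a1) + of_real (Re a2) + of_real (Re a3) + 2) * ?k (of_real (Re a1)) (of_real (Re a2)) \<tau>)" for \<tau>
      unfolding norm using a by (intro inner) auto
    show "integrable lborel (\<lambda>\<tau>. Gamma (of_real (Re a1) + of_real (Re a2) + of_real (Re a3) + 2) *
        ?k (of_real (Re a1)) (of_real (Re a2)) \<tau>)"
      using a by (intro integrable_mult_right k) auto
    show "has_bochner_integral lborel (\<lambda>\<tau>. Gamma (a1 + a2 + a3 + 2) * ?k a1 a2 \<tau>)
        (Gamma (a1 + a2 + a3 + 2) * integral\<^sup>L lborel (?k a1 a2))"
      using a by (intro has_bochner_integral_mult_right has_bochner_integral_integrable k) auto
  qed
  \<comment> \<open>For fixed positive \<open>s\<close> this is the substitution t = s \<tau>, whose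
    Jacobian accounts for the extra 1 in the exponent of \<open>s\<close>. For other
    \<open>s\<close> both sides vanish.\<close>
  have eq: "(\<integral>t. gamma_kernel a2 1 t * gamma_kernel a1 1 s * complex_of_real (t + s) powr a3 \<partial>lborel) =
     (\<integral>\<tau>. Q a1 a2 a3 (\<tau>, s) \<partial>lborel)" for s
  proof (cases "s > 0")
    case True
    have "\<bar>s\<bar> *\<^sub>R (gamma_kernel a2 1 (0 + s * \<tau>) * gamma_kernel a1 1 s * complex_of_real (0 + s * \<tau> + s) powr a3) =
        Q a1 a2 a3 (\<tau>, s)" for \<tau>
    proof (cases "\<tau> > 0")
      case \<tau>: True
      have "complex_of_real (s * \<tau>) powr a2 = of_real s powr a2 * of_real \<tau> powr a2"
        using True \<tau> by (simp add: powr_times_real)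
      moreover have "complex_of_real (s * \<tau> + s) powr a3 = of_real s powr a3 * of_real (1 + \<tau>) powr a3"
        using True \<tau> powr_times_real[of "of_real s" "of_real (1 + \<tau>)" a3] by (simp add: algebra_simps)
      moreover have "complex_of_real s powr (a1 + a2 + a3 + 1) =
          of_real s powr a1 * of_real s powr a2 * of_real s powr a3 * of_real s"
        using True by (simp add: powr_add)
      moreover have "exp (- (s * \<tau>)) * exp (- s) = exp ((- 1 - \<tau>) * s)"
        by (simp add: algebra_simps flip: exp_add)
      ultimately show ?thesis
        using True \<tau> by (simp add: Q_def gamma_kernel_def scaleR_conv_of_real mult_ac flip: of_real_mult)
    qed (use True in \<open>auto simp: Q_def gamma_kernel_def zero_less_mult_iff\<close>)
    then show ?thesis using True
      by (subst lborel_integral_real_affine[where c = s and t = 0]) (simp_all flip: integral_scaleR_right)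
  qed (auto simp: Q_def gamma_kernel_def case_prod_unfold)
  have "?lhs = (\<integral>s. \<integral>t. gamma_kernel a2 1 t * gamma_kernel a1 1 s * complex_of_real (t + s) powr a3 \<partial>lborel \<partial>lborel)"
    using lborel_pair.integral_snd[of "\<lambda>t s. gamma_kernel a2 1 t * gamma_kernel a1 1 s * complex_of_real (t + s) powr a3"]
      int by (simp add: lborel_prod)
  also have "\<dots> = (\<integral>s. \<integral>\<tau>. Q a1 a2 a3 (\<tau>, s) \<partial>lborel \<partial>lborel)"
    by (simp only: eq)
  also have "\<dots> = integral\<^sup>L lborel (Q a1 a2 a3)"
    using lborel_pair.integral_snd[of "\<lambda>\<tau> s. Q a1 a2 a3 (\<tau>, s)"] Q by (simp add: lborel_prod has_bochner_integral_iff)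
  also have "\<dots> = Gamma (a1 + a2 + a3 + 2) * integral\<^sup>L lborel (?k a1 a2)"
    using Q by (simp add: has_bochner_integral_iff)
  finally show ?thesis .
qed

lemma has_bochner_integral_lborel_mult:
  fixes f :: "'a::euclidean_space \<Rightarrow> complex" and g :: "'b::euclidean_space \<Rightarrow> complex"
  assumes f: "has_bochner_integral lborel f x" and g: "has_bochner_integral lborel g y"
  shows "has_bochner_integral lborel (\<lambda>(t, s). f t * g s) (x * y)"
proof (rule has_bochner_integral_lborel_pair)
  have [measurable]: "f \<in> borel_measurable borel" "g \<in> borel_measurable borel"
    using f g by (auto dest: borel_measurable_has_bochner_integral)
  show "(\<lambda>(t, s). f t * g s) \<in> borel_measurable borel"
    unfolding case_prod_unfold by measurable
  show "has_bochner_integral lborel (\<lambda>s. case (t, s) of (t, s) \<Rightarrow> f t * g s) (f t * y)" for t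
    unfolding prod.case using g by (intro has_bochner_integral_mult_right)
  have "integrable lborel (\<lambda>s. complex_of_real (norm (g s)))" "integrable lborel (\<lambda>s. complex_of_real (norm (f s)))"
    using f g by (auto simp: has_bochner_integral_iff)
  then show "has_bochner_integral lborel (\<lambda>s. complex_of_real (norm (case (t, s) of (t, s) \<Rightarrow> f t * g s)))
      (of_real (norm (f t)) * (\<integral>s. of_real (norm (g s)) \<partial>lborel))"
    and "integrable lborel (\<lambda>t. of_real (norm (f t)) * (\<integral>s. complex_of_real (norm (g s)) \<partial>lborel))" for t
    by (simp_all add: norm_mult has_bochner_integral_iff)
  show "has_bochner_integral lborel (\<lambda>t. f t * y) (x * y)"
    using f by (intro has_bochner_integral_mult_left)
qed

text \<open>\<open>Gamma\<close> takes the value 0 only at the nonpositive integers, where it has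
  its poles.\<close>

lemma Gamma_nonzero_Re_pos: "Re z > 0 \<Longrightarrow> Gamma z \<noteq> 0"
  by (auto simp: Gamma_eq_zero_iff elim!: nonpos_Ints_cases)

text \<open>At \<open>a3 = 0\<close> the double integral is also a product of two Gamma integrals;
  comparing the two evaluations gives the constant.\<close>

lemma integral_Beta_of_real_powr:
  assumes "Re a1 \<ge> 0" "Re a2 \<ge> 0"
  shows "(\<integral>\<tau>. indicator {0<..} \<tau> *\<^sub>R (complex_of_real \<tau> powr a2 * of_real (1 + \<tau>) powr (- a1 - a2 - 2)) \<partial>lborel) =
     Gamma (a1 + 1) * Gamma (a2 + 1) / Gamma (a1 + a2 + 2)" (is "?K = _")
proof -
  have "has_bochner_integral lborel (gamma_kernel a 1) (Gamma (a + 1))" if "Re a \<ge> 0" for a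
    using integrable_gamma_kernel[of a 1] integral_gamma_kernel[of a 1] that by (simp add: has_bochner_integral_iff)
  from has_bochner_integral_lborel_mult[OF this[OF assms(2)] this[OF assms(1)]]
  have "has_bochner_integral lborel (\<lambda>(t, s). gamma_kernel a2 1 t * gamma_kernel a1 1 s) (Gamma (a2 + 1) * Gamma (a1 + 1))" .
  \<comment> \<open>Where \<open>t + s\<close> is 0 at least one kernel vanishes, so inserting the
    power with exponent 0 changes nothing.\<close>
  also have "(\<lambda>(t, s). gamma_kernel a2 1 t * gamma_kernel a1 1 s) =
      (\<lambda>(t, s). gamma_kernel a2 1 t * gamma_kernel a1 1 s * complex_of_real (t + s) powr 0)"
    by (auto simp: fun_eq_iff gamma_kernel_def indicator_def simp flip: of_real_add)
  finally have "Gamma (a1 + a2 + 2) * ?K = Gamma (a2 + 1) * Gamma (a1 + 1)"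
    using integral_gamma_kernel_pair[of a1 a2 0] assms by (simp add: has_bochner_integral_iff)
  then show ?thesis
    using Gamma_nonzero_Re_pos[of "a1 + a2 + 2"] assms by (simp add: field_simps)
qed

section \<open>Absolute convergence\<close>

lemma cmod_diff_square_le: "(cmod (z - w))\<^sup>2 \<le> (1 + (cmod z)\<^sup>2) * (1 + (cmod w)\<^sup>2)"
proof -
  have "(1 + (cmod z)\<^sup>2) * (1 + (cmod w)\<^sup>2) = (cmod (z - w))\<^sup>2 + (cmod (1 + z * cnj w))\<^sup>2"
    by (simp add: cmod_power2) (simp add: power2_eq_square algebra_simps)
  then show ?thesis by simp
qed

lemma I_C2_integrand_measurable [measurable]: "I_C2_integrand a1 a2 a3 \<in> borel_measurable borel"
  unfolding I_C2_integrand_def case_prod_unfold by measurable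

text \<open>The bound on |z - w|^2 splits the third factor into powers \<open>Re a3\<close> of
  \<open>A\<close> and \<open>B\<close>, which cancel \<open>- Re a3\<close> in the other two
  exponents. What remains is at most \<open>A powr (- 2) * B powr (- 2)\<close>, a product of
  integrable radial functions.\<close>

lemma integrable_I_C2_integrand:
  assumes a: "Re a1 \<ge> 0" "Re a2 \<ge> 0" "Re a3 \<ge> 0"
  shows "integrable lborel (I_C2_integrand a1 a2 a3)"
proof -
  have "integrable lborel (\<lambda>r. complex_of_real (indicator {0<..} r *\<^sub>R (1 / (1 + r)\<^sup>2)))"
    using integrable_inverse_square_shift by (rule integrable_of_real)
  also have "(\<lambda>r. complex_of_real (indicator {0<..} r *\<^sub>R (1 / (1 + r)\<^sup>2))) =
      (\<lambda>r. indicator {0<..} r *\<^sub>R complex_of_real (1 / (1 + r)\<^sup>2))"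
    by (simp add: scaleR_conv_of_real)
  finally obtain I where "has_bochner_integral lborel (\<lambda>r. indicator {0<..} r *\<^sub>R complex_of_real (1 / (1 + r)\<^sup>2)) I"
    by (auto simp: integrable.simps)
  then have 1: "has_bochner_integral lborel (\<lambda>z. complex_of_real (1 / (1 + (cmod z)\<^sup>2)\<^sup>2)) (of_real pi * I)"
    by (rule has_bochner_integral_cmod_square) measurable
  show ?thesis
  proof (rule Bochner_Integration.integrable_bound)
    show "integrable lborel (\<lambda>(z, w). complex_of_real (1 / (1 + (cmod z)\<^sup>2)\<^sup>2) * complex_of_real (1 / (1 + (cmod w)\<^sup>2)\<^sup>2))"
      using has_bochner_integral_lborel_mult[OF 1 1] by (simp add: has_bochner_integral_iff)
    show "AE p in lborel. norm (I_C2_integrand a1 a2 a3 p) \<le>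
        norm (case p of (z, w) \<Rightarrow> complex_of_real (1 / (1 + (cmod z)\<^sup>2)\<^sup>2) * complex_of_real (1 / (1 + (cmod w)\<^sup>2)\<^sup>2))"
    proof (intro AE_I2, clarify)
      fix z w :: complex
      define A B d where "A = 1 + (cmod z)\<^sup>2" "B = 1 + (cmod w)\<^sup>2" "d = cmod (z - w)"
      have AB: "A \<ge> 1" "B \<ge> 1" "d \<ge> 0" "d\<^sup>2 \<le> A * B"
        using cmod_diff_square_le[of z w] by (auto simp: A_B_d_def)
      have cmod: "cmod (complex_of_real x powr a) = x powr Re a" if "x \<ge> 0" for x a
        using that by (subst norm_powr_real_powr) auto
      have "cmod (I_C2_integrand a1 a2 a3 (z, w)) =
          A powr (- 2 - Re a2 - Re a3) * B powr (- 2 - Re a1 - Re a3) * d powr (2 * Re a3)"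
        using AB unfolding I_C2_integrand_def prod.case A_B_d_def [symmetric] by (simp add: norm_mult cmod)
      also have "d powr (2 * Re a3) = (d\<^sup>2) powr Re a3"
        using AB by (cases "d = 0") (simp_all add: powr_powr flip: powr_numeral)
      also have "\<dots> \<le> (A * B) powr Re a3"
        using AB a by (intro powr_mono2) auto
      also have "\<dots> = A powr Re a3 * B powr Re a3"
        using AB by (simp add: powr_mult)
      also have "A powr (- 2 - Re a2 - Re a3) * B powr (- 2 - Re a1 - Re a3) * (A powr Re a3 * B powr Re a3) =
          (A powr (- 2 - Re a2 - Re a3) * A powr Re a3) * (B powr (- 2 - Re a1 - Re a3) * B powr Re a3)"
        by (simp add: mult_ac)
      also have "\<dots> = A powr (- 2 - Re a2) * B powr (- 2 - Re a1)"
        by (simp flip: powr_add)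
      also have "\<dots> \<le> A powr (- 2) * B powr (- 2)"
        using AB a by (intro mult_mono powr_mono) auto
      also have "\<dots> = norm (complex_of_real (1 / A\<^sup>2) * complex_of_real (1 / B\<^sup>2))"
        using AB by (simp add: powr_minus_divide norm_divide norm_mult norm_power)
      finally show "cmod (I_C2_integrand a1 a2 a3 (z, w)) \<le>
          norm (complex_of_real (1 / (1 + (cmod z)\<^sup>2)\<^sup>2) * complex_of_real (1 / (1 + (cmod w)\<^sup>2)\<^sup>2))"
        by (simp add: A_B_d_def mult_left_mono)
    qed
  qed measurable
qed

section \<open>Exchange of the two integrations\<close>

theorem theorem5p3:
  "\<exists>R::real. \<forall>a1 a2 a3 :: complex. Re a1 > R \<longrightarrow> Re a2 > R \<longrightarrow> Re a3 > R \<longrightarrow>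
     integrable lborel (I_C2_integrand a1 a2 a3) \<and>
     I_C2 a1 a2 a3 =
       (complex_of_real pi)\<^sup>2 *
         (Gamma (a1 + a2 + a3 + 2) * Gamma (a1 + 1) * Gamma (a2 + 1) * Gamma (a3 + 1)) /
         (Gamma (a1 + a2 + 2) * Gamma (a1 + a3 + 2) * Gamma (a2 + a3 + 2))"
proof (intro exI allI impI conjI)
  fix a1 a2 a3 :: complex
  assume "Re a1 > 0" "Re a2 > 0" "Re a3 > 0"
  then have a: "Re a1 \<ge> 0" "Re a2 \<ge> 0" "Re a3 \<ge> 0" by auto
  show "integrable lborel (I_C2_integrand a1 a2 a3)"
    using a by (rule integrable_I_C2_integrand)
  \<comment> \<open>The joint integrand in z = (z1, z2) and p = (t, s). The exponents are chosen so
    that integrating over \<open>p\<close> restores the first two factors of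
    \<open>I_C2_integrand\<close> up to Gamma values.\<close>
  define J where "J b1 b2 b3 = (\<lambda>(z, p). gamma_kernel (b2 + b3 + 1) (1 + (cmod (fst z))\<^sup>2) (fst p) *
    gamma_kernel (b1 + b3 + 1) (1 + (cmod (snd z))\<^sup>2) (snd p) * complex_of_real (cmod (fst z - snd z)) powr (2 * b3))"
    for b1 b2 b3
  define h where "h = (\<lambda>(t, s). gamma_kernel a2 1 t * gamma_kernel a1 1 s * complex_of_real (t + s) powr a3)"
  have m: "J a1 a2 a3 \<in> borel_measurable borel"
    unfolding J_def case_prod_unfold by measurable
  have inner: "has_bochner_integral lborel (\<lambda>p. J b1 b2 b3 (z, p))
      (Gamma (b2 + b3 + 2) * Gamma (b1 + b3 + 2) * I_C2_integrand b1 b2 b3 z)"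
    if b: "Re b1 \<ge> 0" "Re b2 \<ge> 0" "Re b3 \<ge> 0" for b1 b2 b3 z
  proof -
    have 1: "has_bochner_integral lborel (gamma_kernel (b + b3 + 1) (1 + (cmod x)\<^sup>2))
       (Gamma (b + b3 + 2) * of_real (1 + (cmod x)\<^sup>2) powr (- 2 - b - b3))" if "Re b \<ge> 0" for b x
    proof -
      have "Re (b + b3 + 1) > - 1" "1 + (cmod x)\<^sup>2 > 0" using that b by (auto simp: add_pos_nonneg)
      moreover have "- 2 - b - b3 = - (b + b3 + 1) - 1" "b + b3 + 2 = b + b3 + 1 + 1" by simp_all
      ultimately show ?thesis
        by (simp only: has_bochner_integral_iff integrable_gamma_kernel integral_gamma_kernel)
    qed
    have "has_bochner_integral lborel (\<lambda>p. J b1 b2 b3 (z, p))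
       ((Gamma (b2 + b3 + 2) * of_real (1 + (cmod (fst z))\<^sup>2) powr (- 2 - b2 - b3)) *
        (Gamma (b1 + b3 + 2) * of_real (1 + (cmod (snd z))\<^sup>2) powr (- 2 - b1 - b3)) *
        complex_of_real (cmod (fst z - snd z)) powr (2 * b3))"
      using has_bochner_integral_mult_left[OF has_bochner_integral_lborel_mult[OF 1[OF b(2), of "fst z"] 1[OF b(1), of "snd z"]],
          of "complex_of_real (cmod (fst z - snd z)) powr (2 * b3)"]
      by (simp add: J_def case_prod_unfold)
    then show ?thesis by (simp add: I_C2_integrand_def case_prod_unfold mult_ac)
  qed
  have norm: "complex_of_real (norm (J a1 a2 a3 p)) = J (of_real (Re a1)) (of_real (Re a2)) (of_real (Re a3)) p" for p
    by (simp add: J_def case_prod_unfold norm_mult of_real_norm_gamma_kernel of_real_norm_of_real_powr)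
  \<comment> \<open>By \<open>norm\<close>, absolute integrability of \<open>J\<close> amounts to
    integrability of \<open>I_C2_integrand\<close> at the real parts.\<close>
  have J: "has_bochner_integral lborel (J a1 a2 a3) (Gamma (a2 + a3 + 2) * Gamma (a1 + a3 + 2) * I_C2 a1 a2 a3)"
    using a integrable_I_C2_integrand
    by (intro has_bochner_integral_lborel_pair[OF m inner[OF a]])
       (auto simp: norm I_C2_def has_bochner_integral_iff[of _ "\<lambda>x. _ * _ * I_C2_integrand _ _ _ x"] intro!: inner)
  have z_integral: "(\<integral>z. J a1 a2 a3 (z, p) \<partial>lborel) = (of_real pi)\<^sup>2 * Gamma (a3 + 1) * h p" for p
  proof (cases p)
    case (Pair t s)
    show ?thesis
    proof (cases "t > 0 \<and> s > 0")
      case True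
      let ?c = "complex_of_real t powr (a2 + a3 + 1) * complex_of_real s powr (a1 + a3 + 1) * of_real (exp (- t - s))"
      have "J a1 a2 a3 (z, p) = ?c * (case z of (z1, z2) \<Rightarrow> complex_of_real (cmod (z1 - z2)) powr (2 * a3) *
         of_real (exp (- t * (cmod z1)\<^sup>2 - s * (cmod z2)\<^sup>2)))" for z
      proof -
        have "exp ((- 1 - (cmod (fst z))\<^sup>2) * t) * exp ((- 1 - (cmod (snd z))\<^sup>2) * s) =
          exp (- t - s) * exp (- t * (cmod (fst z))\<^sup>2 - s * (cmod (snd z))\<^sup>2)"
          by (simp add: algebra_simps flip: exp_add)
        then have "complex_of_real (exp ((- 1 - (cmod (fst z))\<^sup>2) * t)) * of_real (exp ((- 1 - (cmod (snd z))\<^sup>2) * s)) =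
          of_real (exp (- t - s)) * of_real (exp (- t * (cmod (fst z))\<^sup>2 - s * (cmod (snd z))\<^sup>2))"
          by (simp flip: of_real_mult)
        then show ?thesis
          using True by (simp add: J_def gamma_kernel_def Pair case_prod_unfold)
      qed
      moreover have "integral\<^sup>L lborel (\<lambda>(z1, z2). complex_of_real (cmod (z1 - z2)) powr (2 * a3) *
         of_real (exp (- t * (cmod z1)\<^sup>2 - s * (cmod z2)\<^sup>2))) =
         (of_real pi)\<^sup>2 * Gamma (a3 + 1) * of_real (t + s) powr a3 * of_real t powr (- a3 - 1) * of_real s powr (- a3 - 1)"
        using has_bochner_integral_gauss_pair[of a3 t s] True a by (simp add: has_bochner_integral_iff)
      ultimately have "(\<integral>z. J a1 a2 a3 (z, p) \<partial>lborel) =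
          (of_real pi)\<^sup>2 * Gamma (a3 + 1) * of_real (t + s) powr a3 * of_real (exp (- t - s)) *
          (of_real t powr (a2 + a3 + 1) * of_real t powr (- a3 - 1)) *
          (of_real s powr (a1 + a3 + 1) * of_real s powr (- a3 - 1))"
        by (simp add: mult_ac)
      \<comment> \<open>The powers \<open>- a3 - 1\<close> from the Gaussian integral reduce the
        kernel exponents to \<open>a2\<close> and \<open>a1\<close>; only the power of
        \<open>t + s\<close> retains \<open>a3\<close>.\<close>
      also have "\<dots> = (of_real pi)\<^sup>2 * Gamma (a3 + 1) * of_real (t + s) powr a3 * of_real (exp (- t - s)) *
          of_real t powr a2 * of_real s powr a1"
        by (simp flip: powr_add)
      also have "\<dots> = (of_real pi)\<^sup>2 * Gamma (a3 + 1) * h p"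
        using True by (simp add: h_def Pair gamma_kernel_def exp_diff exp_minus field_simps)
      finally show ?thesis .
    qed (auto simp: J_def h_def gamma_kernel_def Pair case_prod_unfold)
  qed
  have "integrable (lborel \<Otimes>\<^sub>M lborel) (\<lambda>(z, p). J a1 a2 a3 (z, p))"
    using J by (simp add: lborel_prod has_bochner_integral_iff)
  note lborel_pair.integrable_snd[OF this] lborel_pair.integral_snd[OF this]
  then have h: "integrable lborel (\<lambda>p. (of_real pi)\<^sup>2 * Gamma (a3 + 1) * h p)"
    "(\<integral>p. (of_real pi)\<^sup>2 * Gamma (a3 + 1) * h p \<partial>lborel) = Gamma (a2 + a3 + 2) * Gamma (a1 + a3 + 2) * I_C2 a1 a2 a3"
    using J by (simp_all add: z_integral lborel_prod has_bochner_integral_iff)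
  \<comment> \<open>Fubini already makes a nonzero multiple of \<open>h\<close> integrable, so
    dividing by the constant replaces a direct estimate.\<close>
  then have "integrable lborel h"
    using integrable_mult_right[OF h(1), of "inverse ((of_real pi)\<^sup>2 * Gamma (a3 + 1))"]
      Gamma_nonzero_Re_pos[of "a3 + 1"] a by (simp add: field_simps)
  then have "integral\<^sup>L lborel h = Gamma (a1 + a2 + a3 + 2) * (Gamma (a1 + 1) * Gamma (a2 + 1) / Gamma (a1 + a2 + 2))"
    using integral_gamma_kernel_pair[of a1 a2 a3] integral_Beta_of_real_powr[of a1 a2] a by (simp add: h_def)
  with h(2) have "Gamma (a2 + a3 + 2) * Gamma (a1 + a3 + 2) * I_C2 a1 a2 a3 =
      (of_real pi)\<^sup>2 * Gamma (a3 + 1) *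
      (Gamma (a1 + a2 + a3 + 2) * (Gamma (a1 + 1) * Gamma (a2 + 1) / Gamma (a1 + a2 + 2)))"
    by simp
  then show "I_C2 a1 a2 a3 =
       (complex_of_real pi)\<^sup>2 *
         (Gamma (a1 + a2 + a3 + 2) * Gamma (a1 + 1) * Gamma (a2 + 1) * Gamma (a3 + 1)) /
         (Gamma (a1 + a2 + 2) * Gamma (a1 + a3 + 2) * Gamma (a2 + a3 + 2))"
    using Gamma_nonzero_Re_pos[of "a1 + a2 + 2"] Gamma_nonzero_Re_pos[of "a1 + a3 + 2"] Gamma_nonzero_Re_pos[of "a2 + a3 + 2"] a
    by (simp add: divide_simps mult_ac)
qed
end
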